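(* Let $p\ge2$ be an integer, $X_i\in\mathscr{M}_r$, $\overline{L}\in\mathbb{R}^{m\times n}$, $\Delta t>0$, and suppose $X_i+\Delta t\,\overline{L}\in\mathscr{M}_r$. Let $\mathcal{R}^{(p)}$ be a retraction that asymptotically approximates $\mathscr{P}_{\mathscr{M}_r}$ to the $p$-th order, and define $X^{(0)}=X_i$ and $$X^{(j)}=\mathcal{R}^{(p)}_{X^{(j-1)}}\big(X_i+\Delta t\,\overline{L}-X^{(j-1)}\big),\qquad j\ge1,$$ with errors $\varepsilon^{(j)}=X^{(j)}-\mathscr{P}_{\mathscr{M}_r}(X_i+\Delta t\,\overline{L})$. Let $\alpha>0$ be a constant such that $\|\varepsilon^{(j)}\|\le\alpha\|X_i+\Delta t\,\overline{L}-X^{(j-1)}\|^p$ for all $j\ge1$. Suppose $\Delta t$ is small enough that, for every $j\ge1$ with $\varepsilon^{(j-1)}\ne0$, $$\big\|\mathscr{P}^{\perp}_{\mathscr{M}_r}(X_i+\Delta t\,\overline{L})\big\|<\left(\frac{\|\varepsilon^{(j-1)}\|}{\alpha}\right)^{1/p}-\|\varepsilon^{(j-1)}\|.$$ Then the iteration converges superlinearly at rate $p$ to the fixed point $X_i+\Delta t\,\overline{L}$: $X^{(j)}\to X_i+\Delta t\,\overline{L}$ as $j\to\infty$ and $\|\varepsilon^{(j)}\|=O(\|\varepsilon^{(j-1)}\|^p)$.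
   Context: $\|\cdot\|$ is the Frobenius norm. $\mathscr{M}_r$ is the manifold of rank-$r$ real $m\times n$ matrices; $\mathscr{P}_{\mathscr{M}_r}$ is the projection onto $\mathscr{M}_r$ (best rank-$r$ approximation in Frobenius norm, i.e. truncated SVD), and $\mathscr{P}^\perp_{\mathscr{M}_r}=I-\mathscr{P}_{\mathscr{M}_r}$, i.e. $\mathscr{P}^\perp_{\mathscr{M}_r}(A)=A-\mathscr{P}_{\mathscr{M}_r}(A)$. In particular $\mathscr{P}_{\mathscr{M}_r}(A)=A$ for $A\in\mathscr{M}_r$. A retraction maps a point $X\in\mathscr{M}_r$ and an increment $D\in\mathbb{R}^{m\times n}$ to a point $\mathcal{R}_X(D)\in\mathscr{M}_r$. It asymptotically approximates $\mathscr{P}_{\mathscr{M}_r}$ to the $p$-th order if $\mathcal{R}^{(p)}_X(D)=\mathscr{P}_{\mathscr{M}_r}(X+D)+O(\|D\|^p)$; for the iteration in the claim this means that a constant $\alpha$ as described there exists. *)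

theory Defs
  imports "HOL-Analysis.Analysis" "HOL-Library.Landau_Symbols"
begin

text \<open>
  An \<open>m \<times> n\<close> matrix has type \<open>real^'n^'m\<close>.  The library norm on this type is
  the Frobenius norm:
\<close>

lemma norm_matrix_Frobenius:
  fixes A :: "real^'n^'m"
  shows "norm A = sqrt (\<Sum>i\<in>UNIV. \<Sum>j\<in>UNIV. (A $ i $ j)^2)"
  by (simp add: norm_vec_def L2_set_def sum_nonneg)

definition fixed_rank :: "nat \<Rightarrow> (real^'n^'m) set" where
  "fixed_rank r = {A. rank A = r}"

text \<open>
  Best rank-\<open>r\<close> approximation.  A closest point of \<open>fixed_rank r\<close> exists exactly
  when \<open>rank A \<ge> r\<close> (with \<open>r \<le> min m n\<close>); ties between minimizers are resolved by an
  arbitrary but fixed choice, as for the truncated SVD.  For \<open>rank A < r\<close> the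
  infimum is not attained and the value is unspecified.
\<close>

definition proj_rank :: "nat \<Rightarrow> real^'n^'m \<Rightarrow> real^'n^'m" where
  "proj_rank r A = closest_point (fixed_rank r) A"

definition proj_rank_perp :: "nat \<Rightarrow> real^'n^'m \<Rightarrow> real^'n^'m" where
  "proj_rank_perp r A = A - proj_rank r A"

definition retraction_rank :: "nat \<Rightarrow> (real^'n^'m \<Rightarrow> real^'n^'m \<Rightarrow> real^'n^'m) \<Rightarrow> bool" where
  "retraction_rank r R \<longleftrightarrow> (\<forall>X\<in>fixed_rank r. \<forall>D. R X D \<in> fixed_rank r)"

text \<open>
  \<open>R X D = proj_rank r (X + D) + O(norm D ^ p)\<close> as \<open>D \<rightarrow> 0\<close>, for each base point \<open>X\<close>; the
  constant and the neighbourhood may depend on \<open>X\<close>.  The filter is \<open>nhds 0\<close> rather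
  than \<open>at 0\<close>, so the estimate also holds at \<open>D = 0\<close>, where (for \<open>p > 0\<close>) it says \<open>R X 0 = X\<close>.
\<close>

definition approximates_proj_to_order ::
    "nat \<Rightarrow> nat \<Rightarrow> (real^'n^'m \<Rightarrow> real^'n^'m \<Rightarrow> real^'n^'m) \<Rightarrow> bool" where
  "approximates_proj_to_order r p R \<longleftrightarrow>
     (\<forall>X\<in>fixed_rank r.
        (\<lambda>D. norm (R X D - proj_rank r (X + D))) \<in> O[nhds 0](\<lambda>D. norm D ^ p))"

end

theory Submission
  imports Defs
begin

text \<open>
  Write \<open>Y = Xi + dt *\<^sub>R L\<close>.  Since \<open>Y\<close> has rank \<open>r\<close>, it is its own projection, so
  its normal part vanishes, the errors are \<open>\<epsilon> j = X j - Y\<close>, and the bound defining \<open>\<alpha>\<close>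
  becomes the recursion \<open>e (j + 1) \<le> \<alpha> * e j ^ p\<close> for \<open>e j = norm (\<epsilon> j)\<close>.  This is
  already convergence of order \<open>p\<close>.

  For the limit, the smallness condition at a starting point with \<open>e 0 > 0\<close> reads
  \<open>0 < (e 0 / \<alpha>) powr (1 / p) - e 0\<close>, that is \<open>\<alpha> * e 0 ^ (p - 1) < 1\<close>
  (\<open>root_gap_imp_contraction_factor_less_one\<close>).  With this factor \<open>t \<mapsto> \<alpha> * t ^ p\<close> shrinks
  every \<open>t\<close> between \<open>0\<close> and \<open>e 0\<close>, so the errors never exceed \<open>e 0\<close> and decay at least
  geometrically (\<open>higher_order_recursion_geometric_bound\<close>).  Finally, the \<open>O\<close>-estimate for the retraction at the base point \<open>Y\<close>
  holds on a neighbourhood that contains the zero increment, which makes \<open>Y\<close> a fixed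
  point.
\<close>

lemma proj_rank_of_fixed_rank:
  "A \<in> fixed_rank r \<Longrightarrow> proj_rank r A = A"
  unfolding proj_rank_def by (rule closest_point_self)

text \<open>
  The right-hand side of the estimate is \<open>0\<close> at the zero increment when \<open>p > 0\<close>, and a
  property that holds near a point holds at that point.
\<close>

lemma approximates_proj_to_order_zero_increment:
  assumes "approximates_proj_to_order r p R" and "p > 0" and "A \<in> fixed_rank r"
  shows "R A 0 = A"
proof -
  have "(\<lambda>D. norm (R A D - proj_rank r (A + D))) \<in> O[nhds 0](\<lambda>D. norm D ^ p)"
    using assms unfolding approximates_proj_to_order_def by blast
  then obtain c where
    "\<forall>\<^sub>F D in nhds 0. norm (norm (R A D - proj_rank r (A + D))) \<le> c * norm (norm D ^ p)"
    by (elim landau_o.bigE)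
  from eventually_nhds_x_imp_x[OF this] show ?thesis
    using assms by (simp add: proj_rank_of_fixed_rank power_0_left)
qed

text \<open>
  Taking \<open>p\<close>-th powers turns the smallness condition, with zero normal part, into a
  contraction factor below one.
\<close>

lemma root_gap_imp_contraction_factor_less_one:
  fixes e \<alpha> :: real
  assumes "p > 0" and "\<alpha> > 0" and "e > 0"
    and gap: "e < (e / \<alpha>) powr (1 / real p)"
  shows "\<alpha> * e ^ (p - 1) < 1"
proof -
  have "e ^ p < ((e / \<alpha>) powr (1 / real p)) ^ p"
    using gap assms by (intro power_strict_mono) auto
  also have "\<dots> = e / \<alpha>"
    using assms by (simp add: powr_realpow[symmetric] powr_powr)
  finally have "(\<alpha> * e ^ (p - 1)) * e < 1 * e"
    using assms by (simp add: field_simps power_eq_if)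
  then show ?thesis
    using \<open>e > 0\<close> by (simp only: mult_less_cancel_right_pos)
qed

text \<open>
  As long as \<open>e n\<close> does not exceed \<open>e 0\<close>, splitting \<open>e n ^ p = e n ^ (p - 1) * e n\<close> bounds
  one step by the factor \<open>\<alpha> * e 0 ^ (p - 1)\<close>.  This factor is at most one, so the
  condition \<open>e n \<le> e 0\<close> propagates.
\<close>

lemma higher_order_recursion_geometric_bound:
  fixes e :: "nat \<Rightarrow> real"
  assumes "p > 0" and "\<alpha> \<ge> 0" and nonneg: "\<And>n. e n \<ge> 0"
    and step: "\<And>n. e (Suc n) \<le> \<alpha> * e n ^ p"
    and factor: "\<alpha> * e 0 ^ (p - 1) \<le> 1"
  shows "e n \<le> (\<alpha> * e 0 ^ (p - 1)) ^ n * e 0"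
proof (induction n)
  case 0
  show ?case by simp
next
  case (Suc n)
  define q where "q = \<alpha> * e 0 ^ (p - 1)"
  have q: "0 \<le> q" "q \<le> 1"
    using assms by (auto simp: q_def)
  have "q ^ n * e 0 \<le> 1 * e 0"
    using q nonneg by (intro mult_right_mono power_le_one) auto
  with Suc have below_start: "e n \<le> e 0"
    by (simp add: q_def)
  have "e (Suc n) \<le> \<alpha> * (e n ^ (p - 1) * e n)"
    using step[of n] \<open>p > 0\<close> by (simp only: power_minus_mult)
  also have "\<dots> \<le> \<alpha> * (e 0 ^ (p - 1) * e n)"
    using below_start nonneg \<open>\<alpha> \<ge> 0\<close> by (intro mult_left_mono mult_right_mono power_mono)
  also have "\<dots> = q * e n"
    by (simp add: q_def)
  also have "\<dots> \<le> q * (q ^ n * e 0)"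
    using Suc q by (intro mult_left_mono) (simp_all add: q_def)
  finally show ?case
    by (simp add: q_def mult.assoc)
qed

theorem lemma3p2:
  fixes r p :: nat
    and Xi L :: "real^'n^'m"
    and dt \<alpha> :: real
    and R :: "real^'n^'m \<Rightarrow> real^'n^'m \<Rightarrow> real^'n^'m"
    and X \<epsilon> :: "nat \<Rightarrow> real^'n^'m"
  assumes "p \<ge> 2"
    and "Xi \<in> fixed_rank r"
    and "dt > 0"
    and "Xi + dt *\<^sub>R L \<in> fixed_rank r"
    and "retraction_rank r R"
    and "approximates_proj_to_order r p R"
    and "X 0 = Xi"
    and "\<And>j. j \<ge> 1 \<Longrightarrow> X j = R (X (j - 1)) (Xi + dt *\<^sub>R L - X (j - 1))"
    and "\<And>j. \<epsilon> j = X j - proj_rank r (Xi + dt *\<^sub>R L)"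
    and "\<alpha> > 0"
    and "\<And>j. j \<ge> 1 \<Longrightarrow> norm (\<epsilon> j) \<le> \<alpha> * norm (Xi + dt *\<^sub>R L - X (j - 1)) ^ p"
    and "\<And>j. j \<ge> 1 \<Longrightarrow> \<epsilon> (j - 1) \<noteq> 0 \<Longrightarrow>
           norm (proj_rank_perp r (Xi + dt *\<^sub>R L))
             < (norm (\<epsilon> (j - 1)) / \<alpha>) powr (1 / real p) - norm (\<epsilon> (j - 1))"
  shows "R (Xi + dt *\<^sub>R L) (Xi + dt *\<^sub>R L - (Xi + dt *\<^sub>R L)) = Xi + dt *\<^sub>R L
    \<and> X \<longlonglongrightarrow> Xi + dt *\<^sub>R L
    \<and> (\<lambda>j. norm (\<epsilon> (Suc j))) \<in> O(\<lambda>j. norm (\<epsilon> j) ^ p)"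
proof -
  define Y where "Y = Xi + dt *\<^sub>R L"
  have Y: "Y \<in> fixed_rank r" and proj: "proj_rank r Y = Y"
    using assms(4) by (simp_all add: Y_def proj_rank_of_fixed_rank)
  have err: "\<epsilon> j = X j - Y" for j
    using assms(9) proj by (simp add: Y_def)
  have step: "norm (\<epsilon> (Suc j)) \<le> \<alpha> * norm (\<epsilon> j) ^ p" for j
    using assms(11)[of "Suc j"] by (simp add: err Y_def[symmetric] norm_minus_commute)

  have factor: "\<alpha> * norm (\<epsilon> 0) ^ (p - 1) < 1"
  proof (cases "\<epsilon> 0 = 0")
    case True
    \<comment> \<open>The smallness condition is void here; the factor is \<open>0\<close> because \<open>p - 1 > 0\<close>.\<close>
    then show ?thesis
      using assms(1) by (simp add: power_0_left)
  next
    case False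
    then have "norm (\<epsilon> 0) < (norm (\<epsilon> 0) / \<alpha>) powr (1 / real p)"
      using assms(12)[of 1] proj by (simp add: Y_def[symmetric] proj_rank_perp_def)
    then show ?thesis
      using False assms(1,10) by (intro root_gap_imp_contraction_factor_less_one) auto
  qed

  have "\<epsilon> \<longlonglongrightarrow> 0"
  proof (rule tendsto_norm_zero_cancel, rule tendsto_sandwich)
    show "\<forall>\<^sub>F n in sequentially. 0 \<le> norm (\<epsilon> n)"
      by simp
    show "\<forall>\<^sub>F n in sequentially.
        norm (\<epsilon> n) \<le> (\<alpha> * norm (\<epsilon> 0) ^ (p - 1)) ^ n * norm (\<epsilon> 0)"
      using higher_order_recursion_geometric_bound[of p \<alpha> "\<lambda>n. norm (\<epsilon> n)"]
        step factor assms(1,10) by (intro always_eventually allI) simp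
    show "(\<lambda>n. (\<alpha> * norm (\<epsilon> 0) ^ (p - 1)) ^ n * norm (\<epsilon> 0)) \<longlonglongrightarrow> 0"
      using factor assms(10) by (intro tendsto_mult_left_zero LIMSEQ_power_zero) simp
  qed simp
  then have "X \<longlonglongrightarrow> Y"
    by (simp add: err[abs_def] LIM_zero_iff)
  moreover have "R Y (Y - Y) = Y"
    using approximates_proj_to_order_zero_increment[OF assms(6) _ Y] assms(1) by simp
  moreover have "(\<lambda>j. norm (\<epsilon> (Suc j))) \<in> O(\<lambda>j. norm (\<epsilon> j) ^ p)"
    using step by (intro bigoI[where c = \<alpha>] always_eventually allI) simp
  ultimately show ?thesis
    by (simp add: Y_def)
qed

end
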